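(* Let $\zeta_5=e^{2\pi i/5}$, and for $\tau\in\mathbb{H}^2$ put $A=\theta[1;\tfrac15]$, $B=\theta[1;\tfrac35]$ and $d_k=\theta[\tfrac35;\tfrac k5]$ for $k\in\{1,3,5,7,9\}$ (theta constants at $\zeta=0$). Then for every $\tau\in\mathbb{H}^2$: $$\frac AB=\frac{d_1^2d_3-\zeta_5^2d_9^2d_7}{\zeta_5d_7^2d_1-\zeta_5d_3^2d_9},\qquad \frac AB=\frac{\zeta_5d_5^2d_7+d_3^2d_1}{d_1^2d_5+\zeta_5d_7^2d_3},$$ $$\frac AB=\frac{\zeta_5d_7^2d_5-\zeta_5d_9^2d_1}{d_1^2d_7+\zeta_5d_5^2d_9},\qquad \frac AB=\frac{-d_1^2d_9+d_3^2d_5}{\zeta_5d_9^2d_3+d_5^2d_1},$$ $$\frac AB=\frac{\zeta_5d_7^2d_9+d_5^2d_3}{d_3^2d_7+\zeta_5d_9^2d_5}.$$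
   Context: Let $\mathbb{H}^2=\{\tau\in\mathbb{C}:\Im\tau>0\}$. For $(\epsilon,\epsilon')\in\mathbb{R}^2$, $$\theta[\epsilon;\epsilon'](\zeta,\tau)=\sum_{n\in\mathbb{Z}}\exp\Big(2\pi i\Big[\tfrac12\big(n+\tfrac{\epsilon}{2}\big)^2\tau+\big(n+\tfrac{\epsilon}{2}\big)\big(\zeta+\tfrac{\epsilon'}{2}\big)\Big]\Big),$$ and $\theta[\epsilon;\epsilon']=\theta[\epsilon;\epsilon'](0,\tau)$ denotes the theta constant, a function of $\tau$. *)

theory Defs
  imports "HOL-Analysis.Analysis"
begin

definition theta_char :: "real \<Rightarrow> real \<Rightarrow> complex \<Rightarrow> complex \<Rightarrow> complex" where
  "theta_char eps eps' z t =
     (\<Sum>\<^sub>\<infinity> n::int. exp (2 * of_real pi * \<i> *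
        ((1/2) * (of_int n + of_real eps / 2)^2 * t
         + (of_int n + of_real eps / 2) * (z + of_real eps' / 2))))"

definition theta_const :: "real \<Rightarrow> real \<Rightarrow> complex \<Rightarrow> complex" where
  "theta_const eps eps' t = theta_char eps eps' 0 t"

end

theory Submission
  imports Defs "HOL-Complex_Analysis.Complex_Analysis"
begin

text \<open>Put \<open>s(z) = \<theta>[1;1](z,\<tau>)\<close>, an odd function with \<open>s(z + 1) = - s(z)\<close>. Up to exponential factors
  the constants are values of \<open>s\<close>: \<open>A\<close> and \<open>B\<close> at \<open>2/5\<close> and \<open>1/5\<close>, and \<open>d\<^sub>k\<close> at
  \<open>\<tau>/5 + (5 - k)/10\<close>. The product \<open>s(x + y) s(x - y)\<close> is a \<open>2 \<times> 2\<close> determinant in the two second-order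
  theta functions, so the Pluecker relation yields
  \<open>s(z) (s(z + a)\<^sup>2 s(z - 2a) - s(z - a)\<^sup>2 s(z + 2a)) = - s(2z) s(a)\<^sup>2 s(2a)\<close>.
  Taking \<open>a = 2/5\<close> and \<open>a = 1/5\<close> and dividing gives a formula for \<open>s(2/5) / s(1/5)\<close>, whose instances
  at \<open>z = \<tau>/5 + j/5\<close> for the five residues \<open>j\<close> modulo 5 are the five identities.

  The division requires that \<open>s\<close> vanish only on the lattice. If \<open>s(u) = 0\<close>, the determinant formula shows
  that translation by \<open>2u\<close> multiplies both second-order theta functions by one entire function that is
  quasi-periodic; by Liouville it is an exponential, which forces \<open>u\<close> into the lattice.\<close>

section \<open>Theta series and their quasi-periodicity\<close>

definition theta_term :: "real \<Rightarrow> real \<Rightarrow> complex \<Rightarrow> complex \<Rightarrow> int \<Rightarrow> complex" where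
  "theta_term eps eps' z t n = exp (2 * of_real pi * \<i> *
        ((1/2) * (of_int n + of_real eps / 2)^2 * t
         + (of_int n + of_real eps / 2) * (z + of_real eps' / 2)))"

lemma theta_char_eq_infsum: "theta_char eps eps' z t = (\<Sum>\<^sub>\<infinity>n. theta_term eps eps' z t n)"
  by (simp add: theta_char_def theta_term_def)

lemma norm_theta_term:
  "norm (theta_term eps eps' z t n) =
     exp (- pi * (of_int n + eps / 2)^2 * Im t - 2 * pi * (of_int n + eps / 2) * Im z)"
proof -
  have *: "(of_int n + of_real eps / 2 :: complex) = of_real (of_int n + eps / 2)" by simp
  show ?thesis
    unfolding theta_term_def norm_exp_eq_Re * of_real_power [symmetric]
    by (simp add: algebra_simps)
qed

section \<open>Absolute and locally uniform convergence, holomorphy in the variable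
  \<open>z\<close>\<close>

lemma summable_on_exp_neg_abs_int: "(\<lambda>n::int. exp (- \<bar>real_of_int n\<bar>)) summable_on UNIV"
proof -
  let ?f = "\<lambda>n::int. exp (- \<bar>real_of_int n\<bar>)"
  have "summable (\<lambda>n. exp (- 1 :: real) ^ n)"
    by (rule summable_geometric) simp
  hence nat: "(\<lambda>n::nat. exp (- real n)) summable_on UNIV"
    by (intro norm_summable_imp_summable_on) (simp flip: exp_of_nat_mult)
  have "?f summable_on (range int \<union> range (\<lambda>n. - int n))"
  proof (rule summable_on_union)
    show "?f summable_on range int"
      using nat by (subst summable_on_reindex) (simp_all add: o_def)
    show "?f summable_on range (\<lambda>n. - int n)"
      using nat by (subst summable_on_reindex) (simp_all add: o_def inj_def)
  qed
  moreover have "n \<in> range int \<union> range (\<lambda>n. - int n)" for n :: int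
    by (cases n rule: int_cases2) auto
  hence "range int \<union> range (\<lambda>n. - int n) = UNIV"
    by blast
  ultimately show ?thesis
    by simp
qed

text \<open>The Gaussian decay in \<open>n\<close> beats the linear exponential growth coming from
  \<open>Im z\<close>. The majorant depends on \<open>z\<close> only through \<open>R\<close>, so it
  serves both absolute summability and the Weierstrass test on horizontal strips.\<close>

lemma theta_term_majorant:
  fixes t :: complex
  assumes "Im t > 0"
  obtains M where "M summable_on (UNIV :: int set)"
    "\<And>n z. \<bar>Im z\<bar> \<le> R \<Longrightarrow> norm (theta_term eps eps' z t n) \<le> M n"
proof
  \<comment> \<open>The extra 1 in \<open>b\<close> leaves room for a factor exp(-|m|) with m = n +
    eps/2. In \<open>K\<close> the first summand is the maximum of b|m| - pi m^2 Im t, found by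
    completing the square; the second pays for passing from |m| to |n|.\<close>
  define b where "b = 2 * pi * R + 1"
  define K where "K = b^2 / (4 * pi * Im t) + \<bar>eps / 2\<bar>"
  show "(\<lambda>n::int. exp K * exp (- \<bar>real_of_int n\<bar>)) summable_on UNIV"
    by (intro summable_on_cmult_right summable_on_exp_neg_abs_int)
  fix n :: int and z :: complex
  assume z: "\<bar>Im z\<bar> \<le> R"
  define m where "m = of_int n + eps / 2"
  have y: "pi * Im t > 0" using assms by simp
  have "- 2 * pi * m * Im z \<le> \<bar>2 * pi * m * Im z\<bar>" by linarith
  also have "\<dots> = 2 * pi * (\<bar>m\<bar> * \<bar>Im z\<bar>)" by (simp add: abs_mult)
  also have "\<dots> \<le> 2 * pi * (\<bar>m\<bar> * R)"
    using z by (intro mult_left_mono) auto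
  finally have 1: "- 2 * pi * m * Im z \<le> 2 * pi * R * \<bar>m\<bar>" by (simp add: mult_ac)
  have "0 \<le> (2 * (pi * Im t) * \<bar>m\<bar> - b)^2 / (4 * (pi * Im t))"
    using y by (intro divide_nonneg_pos) auto
  also have "\<dots> = (pi * Im t) * m^2 - b * \<bar>m\<bar> + b^2 / (4 * (pi * Im t))"
    using assms by (simp add: power2_diff power_mult_distrib add_divide_distrib diff_divide_distrib)
      (simp add: power2_eq_square)
  finally have 2: "b * \<bar>m\<bar> - pi * m^2 * Im t \<le> b^2 / (4 * pi * Im t)"
    by (simp add: algebra_simps)
  have 3: "\<bar>real_of_int n\<bar> \<le> \<bar>m\<bar> + \<bar>eps / 2\<bar>" unfolding m_def by linarith
  have "- pi * m^2 * Im t - 2 * pi * m * Im z \<le> K - \<bar>real_of_int n\<bar>"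
    using 1 2 3 unfolding K_def b_def by (simp add: algebra_simps)
  thus "norm (theta_term eps eps' z t n) \<le> exp K * exp (- \<bar>real_of_int n\<bar>)"
    unfolding norm_theta_term m_def [symmetric] by (simp flip: exp_add)
qed

lemma theta_term_abs_summable:
  assumes "Im t > 0"
  shows "(\<lambda>n. norm (theta_term eps eps' z t n)) summable_on UNIV"
proof -
  obtain M where "M summable_on (UNIV :: int set)"
    "\<And>n w. \<bar>Im w\<bar> \<le> \<bar>Im z\<bar> \<Longrightarrow> norm (theta_term eps eps' w t n) \<le> M n"
    using theta_term_majorant [OF assms] by metis
  thus ?thesis
    by (intro Infinite_Sum.abs_summable_on_comparison_test' [of M]) auto
qed

lemma theta_uniform_limit:
  assumes "Im t > 0" "\<And>z. z \<in> S \<Longrightarrow> \<bar>Im z\<bar> \<le> R"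
  shows "uniform_limit S (\<lambda>X z. \<Sum>n\<in>X. theta_term eps eps' z t n)
           (\<lambda>z. theta_char eps eps' z t) (finite_subsets_at_top UNIV)"
proof -
  obtain M where "M summable_on (UNIV :: int set)"
    "\<And>n w. \<bar>Im w\<bar> \<le> R \<Longrightarrow> norm (theta_term eps eps' w t n) \<le> M n"
    using theta_term_majorant [OF assms(1)] by metis
  thus ?thesis
    unfolding theta_char_eq_infsum
    by (intro Weierstrass_m_test_general) (use assms(2) in auto)
qed

lemma theta_char_holomorphic:
  assumes "Im t > 0"
  shows "(\<lambda>z. theta_char eps eps' z t) holomorphic_on A"
proof -
  have "(\<lambda>z. theta_char eps eps' z t) holomorphic_on ball w 1" for w
  proof (rule holomorphic_uniform_limit)
    show "\<forall>\<^sub>F X in finite_subsets_at_top UNIV.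
        continuous_on (cball w 1) (\<lambda>z. \<Sum>n\<in>X. theta_term eps eps' z t n) \<and>
        (\<lambda>z. \<Sum>n\<in>X. theta_term eps eps' z t n) holomorphic_on ball w 1"
      unfolding theta_term_def
      by (intro always_eventually allI conjI continuous_intros holomorphic_intros)
    show "uniform_limit (cball w 1) (\<lambda>X z. \<Sum>n\<in>X. theta_term eps eps' z t n)
           (\<lambda>z. theta_char eps eps' z t) (finite_subsets_at_top UNIV)"
    proof (rule theta_uniform_limit [OF assms])
      fix z assume "z \<in> cball w 1"
      hence "\<bar>Im (z - w)\<bar> \<le> 1"
        using abs_Im_le_cmod [of "z - w"] by (simp add: dist_norm norm_minus_commute)
      thus "\<bar>Im z\<bar> \<le> \<bar>Im w\<bar> + 1" by simp
    qed
  qed auto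
  hence "(\<lambda>z. theta_char eps eps' z t) holomorphic_on (\<Union>w. ball w 1)"
    by (subst holomorphic_on_UN_open) auto
  moreover have "w \<in> (\<Union>w. ball w 1)" for w :: complex
    by (rule UN_I [of w]) simp_all
  ultimately show ?thesis
    by (meson holomorphic_on_subset subsetI)
qed

section \<open>Translations, reflection, and shifts of the characteristic\<close>

text \<open>Completing the square: with m = n + eps/2, m^2 t/2 + m h t = (m + h)^2 t/2 - h^2 t/2.
  Fractional \<open>h\<close> is allowed, which later relates characteristic 1 to 3/5 and exchanges
  the two second-order functions.\<close>

lemma theta_char_shift:
  "theta_char eps eps' (z + of_real h * t) t =
     exp (- (2 * of_real pi * \<i> * (of_real h ^ 2 * t / 2 + of_real h * (z + of_real eps' / 2)))) *
     theta_char (eps + 2 * h) eps' z t"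
  unfolding theta_char_eq_infsum infsum_cmult_right' [symmetric]
proof (rule infsum_cong)
  fix n :: int
  show "theta_term eps eps' (z + of_real h * t) t n =
     exp (- (2 * of_real pi * \<i> * (of_real h ^ 2 * t / 2 + of_real h * (z + of_real eps' / 2)))) *
     theta_term (eps + 2 * h) eps' z t n"
    unfolding theta_term_def exp_add [symmetric]
    by (rule arg_cong [of _ _ exp]) (simp add: field_simps power2_eq_square)
qed

lemma theta_char_add_real:
  "theta_char eps eps' (z + of_real h) t = theta_char eps (eps' + 2 * h) z t"
  unfolding theta_char_def by (simp add: add_divide_distrib add_ac)

lemma theta_char_eps_add_2: "theta_char (eps + 2) eps' z t = theta_char eps eps' z t"
  unfolding theta_char_eq_infsum
  by (rule infsum_reindex_bij_witness [of _ "\<lambda>n. n - 1" "\<lambda>n. n + 1"])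
     (auto simp: theta_term_def field_simps)

lemma exp_2pi_i_int: "exp (2 * of_real pi * \<i> * of_int n) = 1"
  using exp_integer_2pi [of "of_int n"] by (simp add: mult_ac)

lemma theta_char_eps'_add_2:
  "theta_char eps (eps' + 2) z t = exp (of_real pi * \<i> * of_real eps) * theta_char eps eps' z t"
  unfolding theta_char_eq_infsum infsum_cmult_right' [symmetric]
proof (rule infsum_cong)
  fix n :: int
  have "theta_term eps (eps' + 2) z t n = exp (2 * of_real pi * \<i> * of_int n) *
     (exp (of_real pi * \<i> * of_real eps) * theta_term eps eps' z t n)"
    unfolding theta_term_def exp_add [symmetric]
    by (rule arg_cong [of _ _ exp]) (simp add: field_simps)
  thus "theta_term eps (eps' + 2) z t n =
     exp (of_real pi * \<i> * of_real eps) * theta_term eps eps' z t n"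
    by (simp only: exp_2pi_i_int mult_1)
qed

lemma theta_char_uminus: "theta_char eps eps' (- z) t = theta_char (- eps) (- eps') z t"
  unfolding theta_char_eq_infsum
proof (rule infsum_reindex_bij_witness [of _ uminus uminus])
  show "theta_term (- eps) (- eps') z t (- n) = theta_term eps eps' (- z) t n" for n
    unfolding theta_term_def
    by (rule arg_cong [of _ _ exp]) (simp add: field_simps power2_eq_square)
qed auto

section \<open>The product formula\<close>

text \<open>Fubini for absolutely summable families; the first part makes it legitimate to split and
  reindex the double series afterwards.\<close>

lemma infsum_times:
  fixes f :: "'a \<Rightarrow> complex" and g :: "'b \<Rightarrow> complex"
  assumes "(\<lambda>x. norm (f x)) summable_on A" "(\<lambda>y. norm (g y)) summable_on B"
  shows "(\<lambda>p. norm (f (fst p) * g (snd p))) summable_on A \<times> B"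
    and "infsum f A * infsum g B = (\<Sum>\<^sub>\<infinity>(x, y)\<in>A \<times> B. f x * g y)"
proof -
  show summ: "(\<lambda>p. norm (f (fst p) * g (snd p))) summable_on A \<times> B"
  proof (rule iffD2 [OF Infinite_Sum.abs_summable_on_Sigma_iff], intro conjI ballI)
    show "(\<lambda>y. norm (f (fst (x, y)) * g (snd (x, y)))) summable_on B" for x
      using summable_on_cmult_right [OF assms(2), of "norm (f x)"] by (simp add: norm_mult)
    show "(\<lambda>x. norm (\<Sum>\<^sub>\<infinity>y\<in>B. norm (f (fst (x, y)) * g (snd (x, y))))) summable_on A"
      using summable_on_cmult_left [OF assms(1), of "\<bar>\<Sum>\<^sub>\<infinity>y\<in>B. norm (g y)\<bar>"]
      by (simp add: norm_mult infsum_cmult_right' abs_mult)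
  qed
  have "infsum f A * infsum g B = (\<Sum>\<^sub>\<infinity>x\<in>A. \<Sum>\<^sub>\<infinity>y\<in>B. f x * g y)"
    by (simp add: infsum_cmult_left' infsum_cmult_right')
  also have "\<dots> = (\<Sum>\<^sub>\<infinity>(x, y)\<in>A \<times> B. f x * g y)"
    using abs_summable_summable [OF summ]
    by (intro infsum_Sigma'_banach) (simp add: case_prod_unfold)
  finally show "infsum f A * infsum g B = (\<Sum>\<^sub>\<infinity>(x, y)\<in>A \<times> B. f x * g y)" .
qed

text \<open>The parallelogram identity (n + 1/2)^2 + (m + 1/2)^2 = 2((n + m + 1)/2)^2 + 2((n -
  m)/2)^2 separates the double series into variables with modulus 2t. The parity of n - m decides
  which variable is a half-integer, and the characteristic entry eps' = 1 contributes the sign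
  (-1)^(n + m + 1).\<close>

lemma theta_char_mult:
  assumes "Im t > 0"
  shows "theta_char 1 1 (x + y) t * theta_char 1 1 (x - y) t =
    theta_char 0 0 (2 * x) (2 * t) * theta_char 1 0 (2 * y) (2 * t) -
    theta_char 1 0 (2 * x) (2 * t) * theta_char 0 0 (2 * y) (2 * t)"
proof -
  let ?F = "\<lambda>(n, m). theta_term 1 1 (x + y) t n * theta_term 1 1 (x - y) t m"
  let ?O = "{(n, m). odd (n - m)} :: (int \<times> int) set"
  let ?E = "{(n, m). even (n - m)} :: (int \<times> int) set"
  have t2: "Im (2 * t) > 0" using assms by simp
  note summ = theta_term_abs_summable [OF assms] and summ2 = theta_term_abs_summable [OF t2]
  have F: "?F summable_on UNIV"
    using abs_summable_summable [OF infsum_times(1) [OF summ summ]]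
    by (simp add: case_prod_unfold)
  have OE: "?O \<union> ?E = UNIV" "?O \<inter> ?E = {}" by auto
  have "theta_char 1 1 (x + y) t * theta_char 1 1 (x - y) t = infsum ?F UNIV"
    unfolding theta_char_eq_infsum by (subst infsum_times(2) [OF summ summ]) simp
  also have "\<dots> = infsum ?F ?O + infsum ?F ?E"
    unfolding OE(1) [symmetric] using OE(2)
    by (intro infsum_Un_disjoint summable_on_subset_banach [OF F]) auto
  \<comment> \<open>For odd n - m, (n + m + 1)/2 = k is an integer and (n - m)/2 = l + 1/2; the sign
    is +1.\<close>
  also have "infsum ?F ?O =
      (\<Sum>\<^sub>\<infinity>(k, l)\<in>UNIV. theta_term 0 0 (2 * x) (2 * t) k * theta_term 1 0 (2 * y) (2 * t) l)"
  proof (rule infsum_reindex_bij_witness [of _ "\<lambda>(k, l). (k + l, k - l - 1)"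
        "\<lambda>(n, m). ((n + m + 1) div 2, (n - m - 1) div 2)"])
    fix a :: "int \<times> int" assume "a \<in> ?O"
    then obtain n m where a: "a = (n, m)" and "odd (n - m)" by auto
    then obtain l where "n - m = 2 * l + 1" by (elim oddE)
    hence n: "n = m + 2 * l + 1" by simp
    define k where "k = m + l + 1"
    have a': "a = (k + l, k - l - 1)" using a n by (simp add: k_def)
    show "(case case a of (n, m) \<Rightarrow> ((n + m + 1) div 2, (n - m - 1) div 2) of
        (k, l) \<Rightarrow> (k + l, k - l - 1)) = a"
      by (simp add: a')
    have "theta_term 0 0 (2 * x) (2 * t) k * theta_term 1 0 (2 * y) (2 * t) l =
       exp (2 * of_real pi * \<i> * of_int (- k)) *
         (theta_term 1 1 (x + y) t (k + l) * theta_term 1 1 (x - y) t (k - l - 1))"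
      unfolding theta_term_def exp_add [symmetric]
      by (rule arg_cong [of _ _ exp]) (simp add: field_simps power2_eq_square)
    thus "(case case a of (n, m) \<Rightarrow> ((n + m + 1) div 2, (n - m - 1) div 2) of
        (k, l) \<Rightarrow> theta_term 0 0 (2 * x) (2 * t) k * theta_term 1 0 (2 * y) (2 * t) l) = ?F a"
      unfolding exp_2pi_i_int by (simp add: a')
  qed auto
  \<comment> \<open>For even n - m, (n + m + 1)/2 = k + 1/2 and (n - m)/2 = l; the sign is
    -1.\<close>
  also have "infsum ?F ?E =
      (\<Sum>\<^sub>\<infinity>(k, l)\<in>UNIV. - (theta_term 1 0 (2 * x) (2 * t) k * theta_term 0 0 (2 * y) (2 * t) l))"
  proof (rule infsum_reindex_bij_witness [of _ "\<lambda>(k, l). (k + l, k - l)"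
        "\<lambda>(n, m). ((n + m) div 2, (n - m) div 2)"])
    fix a :: "int \<times> int" assume "a \<in> ?E"
    then obtain n m where a: "a = (n, m)" and "even (n - m)" by auto
    then obtain l where "n - m = 2 * l" by (elim evenE)
    hence n: "n = m + 2 * l" by simp
    define k where "k = m + l"
    have a': "a = (k + l, k - l)" using a n by (simp add: k_def)
    show "(case case a of (n, m) \<Rightarrow> ((n + m) div 2, (n - m) div 2) of
        (k, l) \<Rightarrow> (k + l, k - l)) = a"
      by (simp add: a')
    have "theta_term 1 0 (2 * x) (2 * t) k * theta_term 0 0 (2 * y) (2 * t) l =
       exp (2 * of_real pi * \<i> * of_int (- k - 1)) * exp (of_real pi * \<i>) *
         (theta_term 1 1 (x + y) t (k + l) * theta_term 1 1 (x - y) t (k - l))"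
      unfolding theta_term_def exp_add [symmetric]
      by (rule arg_cong [of _ _ exp]) (simp add: field_simps power2_eq_square)
    thus "(case case a of (n, m) \<Rightarrow> ((n + m) div 2, (n - m) div 2) of
        (k, l) \<Rightarrow> - (theta_term 1 0 (2 * x) (2 * t) k * theta_term 0 0 (2 * y) (2 * t) l)) = ?F a"
      unfolding exp_2pi_i_int by (simp add: a')
  qed auto
  finally show ?thesis
    unfolding theta_char_eq_infsum infsum_times(2) [OF summ2 summ2]
    by (simp add: case_prod_unfold infsum_uminus)
qed

section \<open>Zeros of the odd theta function\<close>

lemma theta_char_1_1_uminus: "theta_char 1 1 (- z) t = - theta_char 1 1 z t"
  using theta_char_eps_add_2 [of "- 1" "- 1" z t] theta_char_eps'_add_2 [of 1 "- 1" z t]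
  by (simp add: theta_char_uminus)

lemma theta_char_1_1_add_1: "theta_char 1 1 (z + 1) t = - theta_char 1 1 z t"
  using theta_char_add_real [of 1 1 z 1 t] theta_char_eps'_add_2 [of 1 1 z t] by simp

section \<open>Non-vanishing by Fourier coefficients\<close>

lemma has_integral_exp_2pi_i_int:
  fixes n :: int
  assumes "n \<noteq> 0"
  shows "((\<lambda>x. exp (2 * of_real pi * \<i> * of_int n * of_real x)) has_integral 0) {0..1::real}"
proof -
  define c where "c = 2 * of_real pi * \<i> * (of_int n :: complex)"
  have c: "c \<noteq> 0" using assms by (simp add: c_def)
  have "((\<lambda>x. exp (c * of_real x)) has_integral exp (c * of_real 1) / c - exp (c * of_real 0) / c)
      {0..1::real}"
  proof (rule fundamental_theorem_of_calculus)
    fix x :: real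
    have "((\<lambda>z. exp (c * z) / c) has_field_derivative exp (c * of_real x)) (at (of_real x))"
      using c by (auto intro!: derivative_eq_intros)
    thus "((\<lambda>x. exp (c * of_real x) / c) has_vector_derivative exp (c * of_real x)) (at x within {0..1})"
      using has_vector_derivative_real_field by blast
  qed simp
  thus ?thesis
    by (simp add: c_def exp_2pi_i_int)
qed

text \<open>On the real line the series is, up to an exponential factor, a uniformly convergent
  Fourier series. Integration over [0,1] isolates its constant coefficient, which is an exponential
  and hence nonzero.\<close>

lemma theta_char_not_identically_0:
  assumes "Im t > 0"
  shows "\<exists>z. theta_char eps eps' z t \<noteq> 0"
proof (rule ccontr)
  assume "\<nexists>z. theta_char eps eps' z t \<noteq> 0"
  hence zero: "(\<Sum>\<^sub>\<infinity>n. theta_term eps eps' z t n) = 0" for z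
    by (simp add: theta_char_eq_infsum)
  \<comment> \<open>The extra factor removes the fractional frequency eps/2, so that every term
    becomes 1-periodic in \<open>x\<close>.\<close>
  define f where "f = (\<lambda>n (x::real). theta_term eps eps' (of_real x) t n * exp (- (of_real pi * \<i> * of_real eps * of_real x)))"
  have f: "f n x = theta_term eps eps' 0 t n * exp (2 * of_real pi * \<i> * of_int n * of_real x)" for n x
    unfolding f_def theta_term_def exp_add [symmetric]
    by (rule arg_cong [of _ _ exp]) (simp add: field_simps)
  obtain M where M: "M summable_on (UNIV :: int set)"
    "\<And>n z. \<bar>Im z\<bar> \<le> 0 \<Longrightarrow> norm (theta_term eps eps' z t n) \<le> M n"
    using theta_term_majorant [OF assms] by metis
  have "uniform_limit {0..1} (\<lambda>X x. \<Sum>n\<in>X. f n x) (\<lambda>x. \<Sum>\<^sub>\<infinity>n. f n x) (finite_subsets_at_top UNIV)"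
    by (rule Weierstrass_m_test_general [OF _ M(1)])
       (use M(2) [of 0] in \<open>simp add: f norm_mult\<close>)
  moreover have "(\<Sum>\<^sub>\<infinity>n. f n x) = 0" for x
    unfolding f_def infsum_cmult_left' zero by simp
  ultimately have "uniform_limit {0..1} (\<lambda>X x. \<Sum>n\<in>X. f n x) (\<lambda>x. 0) (finite_subsets_at_top UNIV)"
    by simp
  moreover have "continuous_on {0..1} (\<lambda>x. \<Sum>n\<in>X. f n x)" for X
    unfolding f by (intro continuous_intros)
  ultimately obtain I J where I: "\<And>X. ((\<lambda>x. \<Sum>n\<in>X. f n x) has_integral I X) {0..1}"
    and J: "((\<lambda>x::real. 0 :: complex) has_integral J) {0..1}"
    and lim: "(I \<longlongrightarrow> J) (finite_subsets_at_top UNIV)"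
    by (rule uniform_limit_integral [OF _ _ finite_subsets_at_top_neq_bot]) (rule that)
  have "J = 0" using J has_integral_0 has_integral_unique by blast
  have f0: "(f n has_integral (if n = 0 then theta_term eps eps' 0 t 0 else 0)) {0..1}" for n
  proof (cases "n = 0")
    case True
    thus ?thesis
      using has_integral_const_real [of "theta_term eps eps' 0 t 0" 0 1] by (simp add: f [abs_def])
  next
    case False
    thus ?thesis
      using has_integral_mult_right [OF has_integral_exp_2pi_i_int [OF False], of "theta_term eps eps' 0 t n"]
      by (simp add: f [abs_def])
  qed
  \<comment> \<open>By orthogonality, the partial sums over all finite \<open>X\<close> containing 0
    have the same integral.\<close>
  have "\<forall>\<^sub>F X in finite_subsets_at_top UNIV. I X = theta_term eps eps' 0 t 0"
    unfolding eventually_finite_subsets_at_top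
  proof (intro exI [of _ "{0}"] conjI allI impI)
    fix X :: "int set"
    assume X: "finite X \<and> {0} \<subseteq> X \<and> X \<subseteq> UNIV"
    have "((\<lambda>x. \<Sum>n\<in>X. f n x) has_integral (\<Sum>n\<in>X. if n = 0 then theta_term eps eps' 0 t 0 else 0)) {0..1}"
      using X f0 by (intro has_integral_sum) auto
    thus "I X = theta_term eps eps' 0 t 0"
      using X has_integral_unique [OF I] by (simp add: sum.delta)
  qed auto
  hence "(I \<longlongrightarrow> theta_term eps eps' 0 t 0) (finite_subsets_at_top UNIV)"
    by (rule tendsto_eventually)
  hence "theta_term eps eps' 0 t 0 = 0"
    using tendsto_unique [OF _ lim] \<open>J = 0\<close> by simp
  thus False
    by (simp add: theta_term_def)
qed

text \<open>At a common zero the product formula would vanish for every \<open>x\<close>, so two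
  translates of the zero set of the odd theta function would cover the plane. That set is
  countable.\<close>

lemma theta_no_common_zero:
  assumes "Im t > 0"
  shows "theta_char 0 0 y (2 * t) \<noteq> 0 \<or> theta_char 1 0 y (2 * t) \<noteq> 0"
proof (rule ccontr)
  assume "\<not> ?thesis"
  hence zero: "theta_char 1 1 (x + y / 2) t * theta_char 1 1 (x - y / 2) t = 0" for x
    by (simp add: theta_char_mult [OF assms])
  let ?Z = "{z \<in> UNIV. theta_char 1 1 z t = 0}"
  have "theta_char 1 1 0 t = 0"
    using theta_char_1_1_uminus [of 0 t] by simp
  hence "\<not> (\<lambda>z. theta_char 1 1 z t) constant_on UNIV"
    using theta_char_not_identically_0 [OF assms, of 1 1] unfolding constant_on_def by (metis UNIV_I)
  hence Z: "countable ?Z"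
    by (intro holomorphic_countable_zeros theta_char_holomorphic assms) auto
  have "x \<in> (\<lambda>z. z - y / 2) ` ?Z \<union> (\<lambda>z. z + y / 2) ` ?Z" for x
  proof -
    have "x + y / 2 \<in> ?Z \<or> x - y / 2 \<in> ?Z"
      using zero [of x] by simp
    thus ?thesis
      by (metis (no_types, lifting) UnI1 UnI2 add_diff_cancel diff_add_cancel image_eqI)
  qed
  hence "countable (UNIV :: complex set)"
    using Z by (intro countable_subset [of UNIV "(\<lambda>z. z - y / 2) ` ?Z \<union> (\<lambda>z. z + y / 2) ` ?Z"]
        countable_Un countable_image) blast+
  thus False
    using uncountable_UNIV_complex by blast
qed

section \<open>Quasi-periodic entire functions and the zero lattice\<close>

lemma norm_periodic_int:
  fixes L :: "complex \<Rightarrow> complex" and k :: int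
  assumes "\<And>z. norm (L (z + w)) = norm (L z)"
  shows "norm (L (z + of_int k * w)) = norm (L z)"
proof (induction k rule: int_induct [of _ 0])
  case (step1 i)
  thus ?case using assms [of "z + of_int i * w"] by (simp add: algebra_simps)
next
  case (step2 i)
  thus ?case using assms [of "z + of_int (i - 1) * w"] by (simp add: algebra_simps)
qed simp

lemma bounded_of_norm_doubly_periodic:
  fixes L :: "complex \<Rightarrow> complex"
  assumes t: "Im t > 0" and cont: "continuous_on UNIV L"
    and "\<And>z. norm (L (z + 1)) = norm (L z)" "\<And>z. norm (L (z + t)) = norm (L z)"
  shows "bounded (range L)"
proof -
  let ?P = "(\<lambda>(a, b). of_real a + of_real b * t) ` ({0..1::real} \<times> {0..1::real})"
  have "compact ?P"
    by (rule compact_continuous_image [OF _ compact_Times [OF compact_Icc compact_Icc]])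
       (simp add: case_prod_unfold, intro continuous_intros)
  hence "bounded (L ` ?P)"
    by (rule compact_imp_bounded [OF compact_continuous_image [OF continuous_on_subset [OF cont subset_UNIV]]])
  then obtain B where "\<forall>w\<in>L ` ?P. norm w \<le> B"
    unfolding bounded_iff ..
  hence B: "norm (L z) \<le> B" if "z \<in> ?P" for z
    using that by (meson imageI)
  have "norm (L z) \<le> B" for z
  proof -
    \<comment> \<open>These are the coordinates of \<open>z\<close> in the real basis 1,
      \<open>t\<close>; their fractional parts lie in the compact parallelogram
      \<open>?P\<close>.\<close>
    define b where "b = Im z / Im t"
    define a where "a = Re z - b * Re t"
    have "z = of_real a + of_real b * t"
      using t by (simp add: a_def b_def complex_eq_iff)
    hence z: "z = (of_real (frac a) + of_real (frac b) * t) + of_int \<lfloor>a\<rfloor> * 1 + of_int \<lfloor>b\<rfloor> * t"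
      by (simp add: frac_def algebra_simps)
    have "norm (L z) = norm (L (of_real (frac a) + of_real (frac b) * t))"
      by (subst z) (simp only: norm_periodic_int [of L, OF assms(3)] norm_periodic_int [of L, OF assms(4)])
    also have "\<dots> \<le> B"
      by (rule B) (auto simp: frac_lt_1 less_imp_le intro!: image_eqI [of _ _ "(frac a, frac b)"])
    finally show ?thesis .
  qed
  thus ?thesis by (auto simp: bounded_iff)
qed

text \<open>An exponential factor makes the modulus of \<open>F\<close> doubly periodic, so by
  Liouville \<open>F\<close> itself is an exponential. The period 1 makes its frequency an integer,
  and the multiplier for \<open>t\<close> then determines \<open>u\<close> modulo the
  integers.\<close>

lemma quasi_periodic_multiplier_in_lattice:
  assumes t: "Im t > 0" and hol: "F holomorphic_on UNIV" and nz: "F w \<noteq> 0"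
    and F1: "\<And>z. F (z + 1) = F z"
    and Ft: "\<And>z. F (z + t) = exp (- (2 * of_real pi * \<i> * u)) * F z"
  shows "\<exists>m n::int. u = of_int m + of_int n * t"
proof -
  \<comment> \<open>This is the unique real \<open>r\<close> for which exp(2 pi i r t) and the
    multiplier exp(-2 pi i u) have inverse moduli; multiplying by exp(2 pi i r z) with
    \<open>r\<close> real keeps the modulus 1-periodic.\<close>
  define r where "r = Im u / Im t"
  define L where "L = (\<lambda>z. exp (2 * of_real pi * \<i> * of_real r * z) * F z)"
  have Lhol: "L holomorphic_on UNIV"
    unfolding L_def by (intro holomorphic_intros hol)
  have "bounded (range L)"
  proof (rule bounded_of_norm_doubly_periodic [OF t holomorphic_on_imp_continuous_on [OF Lhol]])
    show "norm (L (z + 1)) = norm (L z)" for z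
      by (simp add: L_def F1 norm_mult)
    have "r * Im t = Im u" using t by (simp add: r_def)
    thus "norm (L (z + t)) = norm (L z)" for z
      by (simp add: L_def Ft norm_mult flip: exp_add) (simp add: algebra_simps flip: exp_add)
  qed
  then obtain c where c: "\<And>z. L z = c"
    using Liouville_theorem [OF Lhol] unfolding constant_on_def by blast
  have Fc: "F z = exp (- (2 * of_real pi * \<i> * of_real r * z)) * c" for z
    unfolding c [of z, symmetric] L_def by (simp flip: exp_add mult.assoc)
  have "c \<noteq> 0" using nz Fc [of w] by auto
  have "exp (- (2 * of_real pi * \<i> * of_real r)) = exp 0"
    using F1 [of 0] \<open>c \<noteq> 0\<close> by (simp add: Fc)
  then obtain n :: int where
    n: "- (2 * of_real pi * \<i> * of_real r) = of_int (2 * n) * of_real pi * \<i>"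
    unfolding exp_eq of_real_mult of_real_of_int_eq add_0_left by blast
  have "exp (- (2 * of_real pi * \<i> * of_real r * t)) = exp (- (2 * of_real pi * \<i> * u))"
    using Ft [of 0] \<open>c \<noteq> 0\<close> by (simp add: Fc)
  then obtain m :: int where
    "- (2 * of_real pi * \<i> * of_real r * t) = - (2 * of_real pi * \<i> * u) + of_int (2 * m) * of_real pi * \<i>"
    unfolding exp_eq of_real_mult of_real_of_int_eq by blast
  hence "(2 * of_real pi * \<i>) * u = of_int (2 * m) * of_real pi * \<i> - (- (2 * of_real pi * \<i> * of_real r)) * t"
    by (simp add: algebra_simps)
  also have "\<dots> = (2 * of_real pi * \<i>) * (of_int m + of_int (- n) * t)"
    unfolding n by (simp add: algebra_simps)
  finally have "u = of_int m + of_int (- n) * t"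
    by (subst (asm) mult_cancel_left) simp
  thus ?thesis by blast
qed

lemma theta_char_1_1_eq_0_imp:
  assumes t: "Im t > 0" and u: "theta_char 1 1 u t = 0"
  shows "\<exists>m n::int. u = of_int m + of_int n * t"
proof -
  define f where "f = (\<lambda>z. theta_char 0 0 z (2 * t))"
  define g where "g = (\<lambda>z. theta_char 1 0 z (2 * t))"
  have hol: "f holomorphic_on A" "g holomorphic_on A" for A
    unfolding f_def g_def using t by (auto intro: theta_char_holomorphic)
  have nz: "f z \<noteq> 0 \<or> g z \<noteq> 0" for z
    unfolding f_def g_def by (rule theta_no_common_zero [OF t])
  \<comment> \<open>With x = z/2 + u and y = z/2, the factor at x - y = u vanishes, hence so does
    the determinant: the vector (f, g) at z + 2u is parallel to the one at z.\<close>
  have det: "f (z + 2 * u) * g z = g (z + 2 * u) * f z" for z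
    using theta_char_mult [OF t, of "z / 2 + u" "z / 2"] u
    by (simp add: f_def g_def algebra_simps)
  \<comment> \<open>\<open>F\<close> is the factor of proportionality. Both quotients agree where
    both are defined, and \<open>f\<close>, \<open>g\<close> have no common zero, so
    \<open>F\<close> is entire.\<close>
  define F where "F = (\<lambda>z. if f z \<noteq> 0 then f (z + 2 * u) / f z else g (z + 2 * u) / g z)"
  have Ff: "f (z + 2 * u) = F z * f z" and Fg: "g (z + 2 * u) = F z * g z" for z
    using det [of z] nz [of z] by (auto simp: F_def field_simps)
  have opn: "open {z. h z \<noteq> 0}" if "h holomorphic_on UNIV" for h :: "complex \<Rightarrow> complex"
    using that by (intro open_Collect_neq holomorphic_on_imp_continuous_on) auto
  have hol_shift: "(\<lambda>z. h (z + 2 * u)) holomorphic_on A" if "h holomorphic_on UNIV" for h A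
  proof -
    have "h \<circ> (\<lambda>z. z + 2 * u) holomorphic_on A"
      by (rule holomorphic_on_compose_gen [OF _ that]) (auto intro!: holomorphic_intros)
    thus ?thesis by (simp add: o_def)
  qed
  have "F holomorphic_on {z. f z \<noteq> 0}"
    by (rule holomorphic_transform [of "\<lambda>z. f (z + 2 * u) / f z"])
       (auto simp: F_def intro!: holomorphic_on_divide hol hol_shift)
  moreover have "F holomorphic_on {z. g z \<noteq> 0}"
    by (rule holomorphic_transform [of "\<lambda>z. g (z + 2 * u) / g z"])
       (intro holomorphic_on_divide hol hol_shift, simp_all add: Fg)
  ultimately have "F holomorphic_on {z. f z \<noteq> 0} \<union> {z. g z \<noteq> 0}"
    by (intro holomorphic_on_Un opn hol)
  moreover have "{z. f z \<noteq> 0} \<union> {z. g z \<noteq> 0} = UNIV"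
    using nz by auto
  ultimately have Fhol: "F holomorphic_on UNIV" by simp
  \<comment> \<open>Otherwise \<open>f\<close> and \<open>g\<close> would both vanish at 2u.\<close>
  have "F 0 \<noteq> 0"
    using nz [of "2 * u"] Ff [of 0] Fg [of 0] by auto
  have f1: "f (z + 1) = f z" for z
    using theta_char_add_real [of 0 0 z 1 "2 * t"] theta_char_eps'_add_2 [of 0 0 z "2 * t"]
    by (simp add: f_def)
  have g1: "g (z + 1) = - g z" for z
    using theta_char_add_real [of 1 0 z 1 "2 * t"] theta_char_eps'_add_2 [of 1 0 z "2 * t"]
    by (simp add: g_def)
  \<comment> \<open>For modulus 2t, translation by \<open>t\<close> is a half-period: it exchanges
    \<open>f\<close> and \<open>g\<close> with the same factor \<open>e\<close>. The change of
    \<open>e\<close> under z -> z + 2u is exactly the multiplier of \<open>F\<close>.\<close>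
  define e where "e = (\<lambda>z. exp (- (2 * of_real pi * \<i> * (t / 4 + z / 2))))"
  have ft: "f (z + t) = e z * g z" for z
    using theta_char_shift [of 0 0 z "1/2" "2 * t"]
    by (simp add: f_def g_def e_def power2_eq_square)
  have gt: "g (z + t) = e z * f z" for z
    using theta_char_shift [of 1 0 z "1/2" "2 * t"] theta_char_eps_add_2 [of 0 0 z "2 * t"]
    by (simp add: f_def g_def e_def power2_eq_square)
  have e: "e (z + 2 * u) = exp (- (2 * of_real pi * \<i> * u)) * e z" for z
    unfolding e_def exp_add [symmetric]
    by (rule arg_cong [of _ _ exp]) (simp add: field_simps)
  have e0: "e z \<noteq> 0" for z by (simp add: e_def)
  have "F (z + 1) = F z" for z
    using Ff [of "z + 1"] Fg [of "z + 1"] Ff [of z] Fg [of z] f1 [of z] g1 [of z]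
      f1 [of "z + 2 * u"] g1 [of "z + 2 * u"] nz [of z]
    by (auto simp: add_ac)
  moreover have "F (z + t) = exp (- (2 * of_real pi * \<i> * u)) * F z" for z
  proof -
    have swap: "z + t + 2 * u = z + 2 * u + t" by simp
    have "F (z + t) * (e z * g z) = exp (- (2 * of_real pi * \<i> * u)) * F z * (e z * g z)"
      using Ff [of "z + t"] unfolding swap ft Fg e by (simp only: mult_ac)
    moreover have "F (z + t) * (e z * f z) = exp (- (2 * of_real pi * \<i> * u)) * F z * (e z * f z)"
      using Fg [of "z + t"] unfolding swap gt Ff e by (simp only: mult_ac)
    ultimately show ?thesis
      using nz [of z] e0 [of z] by auto
  qed
  ultimately show ?thesis
    using quasi_periodic_multiplier_in_lattice [of t F 0 u] t Fhol \<open>F 0 \<noteq> 0\<close> by blast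
qed

lemma theta_char_1_1_ne_0:
  assumes t: "Im t > 0" and "x \<notin> \<int> \<or> y \<notin> \<int>"
  shows "theta_char 1 1 (of_real x + of_real y * t) t \<noteq> 0"
proof
  assume "theta_char 1 1 (of_real x + of_real y * t) t = 0"
  then obtain m n :: int where *: "of_real x + of_real y * t = of_int m + of_int n * t"
    using theta_char_1_1_eq_0_imp [OF t] by blast
  from arg_cong [OF *, of Im] have "y = of_int n" using t by simp
  moreover from this have "x = of_int m" using arg_cong [OF *, of Re] t by simp
  ultimately show False using assms(2) by simp
qed

section \<open>Values at fifths\<close>

text \<open>Write [x y] = f x * g y - g x * f y = s(x + y) s(x - y). The claim is the Pluecker
  relation [k q][p l] - [p q][k l] = -[k p][l q].\<close>

lemma theta_char_1_1_duplication:
  assumes "Im t > 0" and s: "s = (\<lambda>z. theta_char 1 1 z t)"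
  shows "s z * (s (z + a)^2 * s (z - 2 * a) - s (z - a)^2 * s (z + 2 * a)) =
         - (s (2 * z) * s a ^ 2 * s (2 * a))"
proof -
  define f where "f = (\<lambda>z. theta_char 0 0 (2 * z) (2 * t))"
  define g where "g = (\<lambda>z. theta_char 1 0 (2 * z) (2 * t))"
  have w: "s u * s v = f x * g y - g x * f y" if "u = x + y" "v = x - y" for u v x y
    using theta_char_mult [OF assms(1)] that by (simp add: s f_def g_def)
  \<comment> \<open>The four points are chosen so that their pairwise sums and differences give
    exactly the arguments in the claim.\<close>
  define p q k l where "p = z - a / 2" and "q = a / 2" and "k = z + a / 2" and "l = 3 * a / 2"
  note defs = p_def q_def k_def l_def
  have pq: "s z * s (z - a) = f p * g q - g p * f q"
    by (rule w) (simp_all add: defs)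
  have kl: "s (z + 2 * a) * s (z - a) = f k * g l - g k * f l"
    by (rule w) (simp_all add: defs field_simps)
  have kq: "s (z + a) * s z = f k * g q - g k * f q"
    by (rule w) (simp_all add: defs)
  have pl: "s (z + a) * s (z - 2 * a) = f p * g l - g p * f l"
    by (rule w) (simp_all add: defs field_simps)
  have kp: "s (2 * z) * s a = f k * g p - g k * f p"
    by (rule w) (simp_all add: defs)
  have lq: "s (2 * a) * s a = f l * g q - g l * f q"
    by (rule w) (simp_all add: defs)
  have "s z * (s (z + a)^2 * s (z - 2 * a) - s (z - a)^2 * s (z + 2 * a)) =
     (s (z + a) * s z) * (s (z + a) * s (z - 2 * a)) - (s z * s (z - a)) * (s (z + 2 * a) * s (z - a))"
    by (simp add: algebra_simps power2_eq_square)
  also have "\<dots> = - ((s (2 * z) * s a) * (s (2 * a) * s a))"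
    unfolding pq kl kq pl kp lq by algebra
  finally show ?thesis
    by (simp add: power2_eq_square mult_ac)
qed

lemma fifths_notin_Ints: "(1 / 5 :: real) \<notin> \<int>" "(2 / 5 :: real) \<notin> \<int>"
  by (auto elim!: Ints_cases simp: field_simps)

text \<open>Since s(4/5) = s(1/5), duplication with a = 2/5 and a = 1/5 gives right-hand sides whose
  quotient is s(2/5)/s(1/5); the values at \<open>z\<close> and 2z cancel.\<close>

lemma theta_fifth_ratio:
  assumes t: "Im t > 0" and s: "s = (\<lambda>z. theta_char 1 1 z t)"
    and nz: "s z \<noteq> 0" "s (2 * z) \<noteq> 0"
  shows "s (2 / 5) / s (1 / 5) =
    (s (z + 2 / 5)^2 * s (z + 1 / 5) - s (z - 2 / 5)^2 * s (z - 1 / 5)) /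
    (s (z - 1 / 5)^2 * s (z + 2 / 5) - s (z + 1 / 5)^2 * s (z - 2 / 5))" (is "_ = ?U / ?V")
proof -
  have odd: "s (- z) = - s z" for z
    by (simp add: s theta_char_1_1_uminus)
  have s1: "s x = - s y" if "x = y + 1" for x y
    by (simp add: that s theta_char_1_1_add_1)
  have c: "s (2 / 5) \<noteq> 0" "s (1 / 5) \<noteq> 0"
    using theta_char_1_1_ne_0 [OF t, of "2/5" 0] theta_char_1_1_ne_0 [OF t, of "1/5" 0]
    by (simp_all add: s fifths_notin_Ints)
  have shifts: "s (z + 1 / 5) = - s (z - 2 * (2 / 5))" "s (z + 2 * (2 / 5)) = - s (z - 1 / 5)"
      "s (2 * (2 / 5)) = - s (- (1 / 5))"
    by (rule s1; simp add: field_simps)+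
  have U: "s z * ?U = s (2 * z) * s (2 / 5)^2 * s (1 / 5)"
    using theta_char_1_1_duplication [OF t s, of z "2 / 5"] unfolding shifts odd by algebra
  have V: "s z * ?V = s (2 * z) * s (1 / 5)^2 * s (2 / 5)"
    using theta_char_1_1_duplication [OF t s, of z "1 / 5"] by (simp add: algebra_simps)
  have "?U / ?V = (s z * ?U) / (s z * ?V)"
    using nz by simp
  also have "\<dots> = s (2 / 5) / s (1 / 5)"
    unfolding U V using nz c by (simp add: power2_eq_square)
  finally show ?thesis by simp
qed

text \<open>Translation by -t/5 turns characteristic 1 into 1 - 2/5 = 3/5, the second entry becomes
  a real translation by (e - 1)/2, and oddness reverses the sign of the argument.\<close>

lemma theta_const_three_fifths:
  "theta_const (3 / 5) e t = exp (of_real pi * \<i> * (t / 25 - of_real e / 5)) *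
     - theta_char 1 1 (t / 5 + of_real ((1 - e) / 2)) t"
proof -
  have expo: "2 * of_real pi * \<i> *
      (of_real (- (1 / 5)) ^ 2 * t / 2 + of_real (- (1 / 5)) * (0 + of_real e / 2)) =
      of_real pi * \<i> * (t / 25 - of_real e / 5)"
    by (simp add: power2_eq_square field_simps)
  have "- theta_char 1 1 (t / 5 + of_real ((1 - e) / 2)) t =
      theta_char 1 1 (- t / 5 + of_real ((e - 1) / 2)) t"
    unfolding theta_char_1_1_uminus [symmetric]
    by (rule arg_cong [of _ _ "\<lambda>z. theta_char 1 1 z t"]) (simp add: field_simps)
  also have "\<dots> = theta_char 1 e (- t / 5) t"
    unfolding theta_char_add_real by (simp add: field_simps)
  also have "\<dots> = exp (- (of_real pi * \<i> * (t / 25 - of_real e / 5))) * theta_const (3 / 5) e t"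
    using theta_char_shift [of 1 e 0 "- (1 / 5)" t] unfolding expo by (simp add: theta_const_def)
  finally have *: "- theta_char 1 1 (t / 5 + of_real ((1 - e) / 2)) t =
    exp (- (of_real pi * \<i> * (t / 25 - of_real e / 5))) * theta_const (3 / 5) e t" .
  show ?thesis
    unfolding * by (simp flip: mult.assoc exp_add)
qed

theorem theorem4p6:
  fixes \<tau> :: complex
  assumes "Im \<tau> > 0"
  defines "\<zeta>5 \<equiv> exp (2 * of_real pi * \<i> / 5)"
      and "A \<equiv> theta_const 1 (1/5) \<tau>"
      and "B \<equiv> theta_const 1 (3/5) \<tau>"
      and "d \<equiv> (\<lambda>k::nat. theta_const (3/5) (real k / 5) \<tau>)"
  shows "(A / B = (d 1 ^ 2 * d 3 - \<zeta>5 ^ 2 * d 9 ^ 2 * d 7) / (\<zeta>5 * d 7 ^ 2 * d 1 - \<zeta>5 * d 3 ^ 2 * d 9)) \<and>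
    (A / B = (\<zeta>5 * d 5 ^ 2 * d 7 + d 3 ^ 2 * d 1) / (d 1 ^ 2 * d 5 + \<zeta>5 * d 7 ^ 2 * d 3)) \<and>
    (A / B = (\<zeta>5 * d 7 ^ 2 * d 5 - \<zeta>5 * d 9 ^ 2 * d 1) / (d 1 ^ 2 * d 7 + \<zeta>5 * d 5 ^ 2 * d 9)) \<and>
    (A / B = (- (d 1 ^ 2 * d 9) + d 3 ^ 2 * d 5) / (\<zeta>5 * d 9 ^ 2 * d 3 + d 5 ^ 2 * d 1)) \<and>
    (A / B = (\<zeta>5 * d 7 ^ 2 * d 9 + d 5 ^ 2 * d 3) / (d 3 ^ 2 * d 7 + \<zeta>5 * d 9 ^ 2 * d 5))"
proof -
  define s where "s = (\<lambda>z. theta_char 1 1 z \<tau>)"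
  have s1: "s (x - 1) = - s x" for x
    using theta_char_1_1_add_1 [of "x - 1" \<tau>] by (simp add: s_def)
  have A: "A = - s (2 / 5)"
    using theta_char_add_real [of 1 1 0 "- (2 / 5)" \<tau>]
    by (simp add: A_def theta_const_def s_def flip: theta_char_1_1_uminus)
  have B: "B = - s (1 / 5)"
    using theta_char_add_real [of 1 1 0 "- (1 / 5)" \<tau>]
    by (simp add: B_def theta_const_def s_def flip: theta_char_1_1_uminus)

  define S where "S = (\<lambda>j::int. s (\<tau> / 5 + of_int j / 5))"
  have S5: "S (j - 5) = - S j" for j
    using s1 [of "\<tau> / 5 + of_int j / 5"] by (simp add: S_def diff_divide_distrib algebra_simps)
  have ratio: "A / B = (S (j + 2)^2 * S (j + 1) - S (j - 2)^2 * S (j - 1)) /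
    (S (j - 1)^2 * S (j + 2) - S (j + 1)^2 * S (j - 2))" for j
  proof -
    let ?z = "\<tau> / 5 + of_int j / 5"
    \<comment> \<open>The \<open>\<tau>\<close>-coordinates 1/5 and 2/5 are not integers, so neither
      argument is a lattice point, whatever \<open>j\<close> is.\<close>
    have "s ?z \<noteq> 0" "s (2 * ?z) \<noteq> 0"
      using fifths_notin_Ints theta_char_1_1_ne_0 [OF assms(1), of "1 / 5" "of_int j / 5"]
        theta_char_1_1_ne_0 [OF assms(1), of "2 * of_int j / 5" "2 / 5"]
        theta_char_1_1_ne_0 [OF assms(1), of "of_int j / 5" "1 / 5"]
      by (simp_all add: s_def algebra_simps)
    from theta_fifth_ratio [OF assms(1) s_def this] show ?thesis
      by (simp add: A B S_def add_divide_distrib diff_divide_distrib add_ac add_diff_eq)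
  qed

  \<comment> \<open>With e = k/5 the prefactor of d_k is exp(pi i (\<tau> - k)/25). \<open>C\<close>
    also absorbs the minus sign from oddness.\<close>
  define C \<rho> where "C = - exp (of_real pi * \<i> * \<tau> / 25)" and "\<rho> = exp (- (of_real pi * \<i> / 25))"
  have nz: "C \<noteq> 0" "\<rho> \<noteq> 0" by (simp_all add: C_def \<rho>_def)
  have d: "d k = C * \<rho> ^ k * s (\<tau> / 5 + (5 - of_nat k) / 10)" for k
  proof -
    have *: "exp (of_real pi * \<i> * (\<tau> / 25 - of_real (real k / 5) / 5)) = - C * \<rho> ^ k"
      by (simp add: C_def \<rho>_def field_simps flip: exp_of_nat_mult exp_add)
    have **: "of_real ((1 - real k / 5) / 2) = (5 - of_nat k :: complex) / 10"
      by (simp add: field_simps)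
    show ?thesis
      unfolding d_def theta_const_three_fifths * ** s_def by simp
  qed
  \<comment> \<open>For odd k, (5 - k)/10 = j/5 with j = (5 - k)/2.\<close>
  have dS: "d 1 = C * \<rho> * S 2" "d 3 = C * \<rho> ^ 3 * S 1" "d 5 = C * \<rho> ^ 5 * S 0"
    "d 7 = C * \<rho> ^ 7 * S (- 1)" "d 9 = C * \<rho> ^ 9 * S (- 2)"
    by (simp_all add: d S_def)
  \<comment> \<open>In units of pi i the exponents agree modulo 2: -40/25 = 2/5 - 2.\<close>
  have zeta: "\<zeta>5 = \<rho> ^ 40"
  proof -
    have "\<rho> ^ 40 = exp (2 * of_real pi * \<i> / 5) * exp (2 * of_real pi * \<i> * of_int (- 1))"
      unfolding \<rho>_def exp_of_nat_mult [symmetric] exp_add [symmetric]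
      by (rule arg_cong [of _ _ exp]) (simp add: field_simps)
    thus ?thesis unfolding exp_2pi_i_int by (simp add: \<zeta>5_def)
  qed
  have "\<rho> ^ 50 = exp (2 * of_real pi * \<i> * of_int (- 1))"
    unfolding \<rho>_def exp_of_nat_mult [symmetric]
    by (rule arg_cong [of _ _ exp]) (simp add: field_simps)
  hence \<rho>50: "\<rho> ^ 50 = 1" unfolding exp_2pi_i_int .
  have cancel: "x = c * u / (c * v)" if "x = u / v" "c \<noteq> 0" for x c u v :: complex
    using that by simp
  \<comment> \<open>The five quotients are the quotient of \<open>ratio\<close> for j = 0, -2, 1, -1, 2, expanded by a monomial in C and \<open>\<rho>\<close>.\<close>
  have k: "C ^ 3 * \<rho> ^ n \<noteq> 0" for n using nz by simp
  have "A / B = (d 1 ^ 2 * d 3 - \<zeta>5 ^ 2 * d 9 ^ 2 * d 7) / (\<zeta>5 * d 7 ^ 2 * d 1 - \<zeta>5 * d 3 ^ 2 * d 9)"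
  proof -
    \<comment> \<open>In each quotient all terms carry the same power of \<open>\<rho>\<close>
      modulo 50; here 1 + 1 + 3 = 5 and 80 + 18 + 7 = 105.\<close>
    have "d 1 ^ 2 * d 3 - \<zeta>5 ^ 2 * d 9 ^ 2 * d 7 = C ^ 3 * \<rho> ^ 5 * (S 2 ^ 2 * S 1 - (\<rho> ^ 50) ^ 2 * S (- 2) ^ 2 * S (- 1))"
      unfolding dS zeta by algebra
    moreover have "\<zeta>5 * d 7 ^ 2 * d 1 - \<zeta>5 * d 3 ^ 2 * d 9 = C ^ 3 * \<rho> ^ 5 * (\<rho> ^ 50 * (S (- 1) ^ 2 * S 2 - S 1 ^ 2 * S (- 2)))"
      unfolding dS zeta by algebra
    ultimately show ?thesis
      using cancel [OF ratio [of 0] k [of 5]] by (simp add: \<rho>50)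
  qed
  moreover have "A / B = (\<zeta>5 * d 5 ^ 2 * d 7 + d 3 ^ 2 * d 1) / (d 1 ^ 2 * d 5 + \<zeta>5 * d 7 ^ 2 * d 3)"
  proof -
    have "\<zeta>5 * d 5 ^ 2 * d 7 + d 3 ^ 2 * d 1 = C ^ 3 * \<rho> ^ 7 * (\<rho> ^ 50 * S 0 ^ 2 * S (- 1) + S 1 ^ 2 * S 2)"
      unfolding dS zeta by algebra
    moreover have "d 1 ^ 2 * d 5 + \<zeta>5 * d 7 ^ 2 * d 3 = C ^ 3 * \<rho> ^ 7 * (S 2 ^ 2 * S 0 + \<rho> ^ 50 * S (- 1) ^ 2 * S 1)"
      unfolding dS zeta by algebra
    ultimately show ?thesis
      using cancel [OF ratio [of "- 2"] k [of 7]] S5 [of 1] S5 [of 2] by (simp add: \<rho>50)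
  qed
  moreover have "A / B = (\<zeta>5 * d 7 ^ 2 * d 5 - \<zeta>5 * d 9 ^ 2 * d 1) / (d 1 ^ 2 * d 7 + \<zeta>5 * d 5 ^ 2 * d 9)"
  proof -
    \<comment> \<open>For j = 1 the index 3 wraps around to -2 with a sign change; the overall sign
      left over is put into the cancelled monomial.\<close>
    have "\<zeta>5 * d 7 ^ 2 * d 5 - \<zeta>5 * d 9 ^ 2 * d 1 = - (C ^ 3 * \<rho> ^ 9) * (\<rho> ^ 50 * (S (- 2) ^ 2 * S 2 - S (- 1) ^ 2 * S 0))"
      unfolding dS zeta by algebra
    moreover have "d 1 ^ 2 * d 7 + \<zeta>5 * d 5 ^ 2 * d 9 = - (C ^ 3 * \<rho> ^ 9) * (- (\<rho> ^ 50 * S 0 ^ 2 * S (- 2)) - S 2 ^ 2 * S (- 1))"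
      unfolding dS zeta by algebra
    ultimately show ?thesis
      using cancel [OF ratio [of 1], of "- (C ^ 3 * \<rho> ^ 9)"] k [of 9] S5 [of 3] by (simp add: \<rho>50)
  qed
  moreover have "A / B = (- (d 1 ^ 2 * d 9) + d 3 ^ 2 * d 5) / (\<zeta>5 * d 9 ^ 2 * d 3 + d 5 ^ 2 * d 1)"
  proof -
    have "- (d 1 ^ 2 * d 9) + d 3 ^ 2 * d 5 = C ^ 3 * \<rho> ^ 11 * (S 1 ^ 2 * S 0 - S 2 ^ 2 * S (- 2))"
      unfolding dS zeta by algebra
    moreover have "\<zeta>5 * d 9 ^ 2 * d 3 + d 5 ^ 2 * d 1 = C ^ 3 * \<rho> ^ 11 * (\<rho> ^ 50 * S (- 2) ^ 2 * S 1 + S 0 ^ 2 * S 2)"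
      unfolding dS zeta by algebra
    ultimately show ?thesis
      using cancel [OF ratio [of "- 1"] k [of 11]] S5 [of 2] by (simp add: \<rho>50)
  qed
  moreover have "A / B = (\<zeta>5 * d 7 ^ 2 * d 9 + d 5 ^ 2 * d 3) / (d 3 ^ 2 * d 7 + \<zeta>5 * d 9 ^ 2 * d 5)"
  proof -
    have "\<zeta>5 * d 7 ^ 2 * d 9 + d 5 ^ 2 * d 3 = - (C ^ 3 * \<rho> ^ 13) * (- (\<rho> ^ 50 * S (- 1) ^ 2 * S (- 2)) - S 0 ^ 2 * S 1)"
      unfolding dS zeta by algebra
    moreover have "d 3 ^ 2 * d 7 + \<zeta>5 * d 9 ^ 2 * d 5 = - (C ^ 3 * \<rho> ^ 13) * (- (S 1 ^ 2 * S (- 1)) - \<rho> ^ 50 * S (- 2) ^ 2 * S 0)"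
      unfolding dS zeta by algebra
    ultimately show ?thesis
      using cancel [OF ratio [of 2], of "- (C ^ 3 * \<rho> ^ 13)"] k [of 13] S5 [of 3] S5 [of 4] by (simp add: \<rho>50)
  qed
  ultimately show ?thesis by blast
qed

end
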